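(* For every fixed real $\alpha\in(0,1)$ and every fixed integer $t\ge 2$, $$\dim_t\big(\mathcal{D}_{(\alpha n, n]}\big) = \Theta_{\alpha,t}(\log n)\quad\text{as } n\to\infty.$$ That is, there exist constants $c, C>0$ and $n_0$, depending only on $\alpha$ and $t$, such that $c\log n \le \dim_t\big(\mathcal{D}_{(\alpha n,n]}\big)\le C\log n$ for all integers $n\ge n_0$. In particular, $\dim_2\big(\mathcal{D}_{(\alpha n, n]}\big) = \Theta_{\alpha}(\log n)$.
   Context: $\mathcal{D}_{(\alpha n,n]}$ denotes the set of integers $m$ with $\alpha n < m \le n$, partially ordered by divisibility ($a \le b$ iff $a\mid b$). A poset embedding $P \hookrightarrow Q$ is a map $\varphi$ with $\varphi(a)\le_Q\varphi(b)$ if and only if $a\le_P b$. For an integer $t\ge2$, the $t$-dimension $\dim_t(P)$ of a finite poset $P$ is the minimum $d$ such that $P$ embeds into a product (with the coordinatewise order) of $d$ linear orders, each of cardinality at most $t$. $\log$ is the natural logarithm. *)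

theory Defs
  imports "HOL-Library.FuncSet" "HOL-Library.Landau_Symbols"
begin

definition poset_embedding ::
  "'a set \<Rightarrow> 'a rel \<Rightarrow> 'b set \<Rightarrow> 'b rel \<Rightarrow> ('a \<Rightarrow> 'b) \<Rightarrow> bool" where
  "poset_embedding A r B s \<phi> \<longleftrightarrow>
     \<phi> \<in> A \<rightarrow> B \<and> (\<forall>a\<in>A. \<forall>b\<in>A. (\<phi> a, \<phi> b) \<in> s \<longleftrightarrow> (a, b) \<in> r)"

definition coordinatewise_order ::
  "'i set \<Rightarrow> ('i \<Rightarrow> 'a set) \<Rightarrow> ('i \<Rightarrow> 'a rel) \<Rightarrow> ('i \<Rightarrow> 'a) rel" where
  "coordinatewise_order I C R =
     {(f, g). f \<in> Pi\<^sub>E I C \<and> g \<in> Pi\<^sub>E I C \<and> (\<forall>i\<in>I. (f i, g i) \<in> R i)}"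

text \<open>The chains are taken with carriers inside \<^typ>\<open>nat\<close>; as they are finite, this is
  no restriction up to isomorphism.\<close>

definition embeds_in_chain_product :: "nat \<Rightarrow> nat \<Rightarrow> 'a set \<Rightarrow> 'a rel \<Rightarrow> bool" where
  "embeds_in_chain_product t d A r \<longleftrightarrow>
     (\<exists>(C :: nat \<Rightarrow> nat set) R \<phi>.
        (\<forall>i<d. finite (C i) \<and> card (C i) \<le> t \<and> linear_order_on (C i) (R i)) \<and>
        poset_embedding A r (Pi\<^sub>E {..<d} C) (coordinatewise_order {..<d} C R) \<phi>)"

text \<open>Meaningful for finite posets and \<open>t \<ge> 2\<close>, where a suitable \<open>d\<close> always exists.\<close>

definition tdim :: "nat \<Rightarrow> 'a set \<Rightarrow> 'a rel \<Rightarrow> nat" where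
  "tdim t A r = (LEAST d. embeds_in_chain_product t d A r)"

definition div_carrier :: "real \<Rightarrow> nat \<Rightarrow> nat set" where
  "div_carrier \<alpha> n = {m. \<alpha> * real n < real m \<and> m \<le> n}"

definition div_order :: "real \<Rightarrow> nat \<Rightarrow> nat rel" where
  "div_order \<alpha> n = {(a, b). a \<in> div_carrier \<alpha> n \<and> b \<in> div_carrier \<alpha> n \<and> a dvd b}"

definition div_tdim :: "nat \<Rightarrow> real \<Rightarrow> nat \<Rightarrow> nat" where
  "div_tdim t \<alpha> n = tdim t (div_carrier \<alpha> n) (div_order \<alpha> n)"

end

theory Submission
  imports Defs
begin

text \<open>
  Lower bound: an embedding of a poset is injective, and a product of \<open>d\<close> chains with at most
  \<open>t\<close> elements has at most \<open>t ^ d\<close> points, while the interval contains at least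
  \<open>(1 - \<alpha>) * n\<close> integers. Hence \<open>d \<ge> log\<^sub>t ((1 - \<alpha>) * n)\<close>.

  Upper bound: two-element chains suffice. A map into a product of \<open>d\<close> such chains is a list of
  \<open>d\<close> up-sets, and it is an embedding when for every pair with \<open>a\<close> not dividing \<open>b\<close> some
  up-set contains \<open>a\<close> but not \<open>b\<close>. If \<open>a\<close> divides \<open>b\<close> inside the interval, then the
  quotient is less than \<open>1 / \<alpha>\<close>, so every \<open>b\<close> has at most \<open>K = \<lfloor>1 / \<alpha>\<rfloor>\<close> divisors there.
  The up-set generated by a uniformly random set \<open>S\<close> of elements therefore separates a given
  pair with probability at least \<open>\<delta> = (1/2) ^ (K + 1)\<close>: it is enough that \<open>S\<close> contains
  \<open>a\<close> and avoids the divisors of \<open>b\<close> (\<open>card_separating_subsets\<close>). Some \<open>S\<close> thus separates a fraction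
  \<open>\<delta>\<close> of any given collection of pairs, and choosing such sets greedily (\<open>greedy_cover\<close>)
  exhausts the at most \<open>n\<^sup>2\<close> pairs after \<open>O(ln n)\<close> steps, with a constant depending only on
  \<open>\<alpha>\<close>.
\<close>

section \<open>Posets with small principal ideals\<close>

text \<open>The map \<open>S \<mapsto> insert a S\<close> embeds the subsets of \<open>A - D - {a}\<close> into the family that is
  counted.\<close>

lemma card_separating_subsets:
  assumes "finite A" "D \<subseteq> A" "card D \<le> K" "a \<in> A" "a \<notin> D"
  shows "(1/2) ^ (K + 1) * real (card (Pow A)) \<le> real (card {S \<in> Pow A. a \<in> S \<and> S \<inter> D = {}})"
proof -
  let ?B = "A - insert a D"
  have finD: "finite D" using assms finite_subset by blast
  have cB: "card A \<le> card ?B + (K + 1)"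
  proof -
    have "card (insert a D) \<le> K + 1" using finD assms by simp
    moreover have "card ?B = card A - card (insert a D)"
      using assms finD by (intro card_Diff_subset) auto
    ultimately show ?thesis by linarith
  qed
  have "card (Pow ?B) = card (insert a ` Pow ?B)"
    by (intro card_image[symmetric] inj_onI) (auto simp: insert_ident)
  also have "\<dots> \<le> card {S \<in> Pow A. a \<in> S \<and> S \<inter> D = {}}"
    using assms by (intro card_mono) auto
  finally have le: "(2::nat) ^ card ?B \<le> card {S \<in> Pow A. a \<in> S \<and> S \<inter> D = {}}"
    using assms(1) by (simp add: card_Pow)
  have "(2::real) ^ card A \<le> 2 ^ (card ?B + (K + 1))"
    using cB by (intro power_increasing) auto
  hence "(1/2) ^ (K + 1) * (2::real) ^ card A \<le> 2 ^ card ?B"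
    by (simp add: power_add field_simps)
  also have "\<dots> \<le> real (card {S \<in> Pow A. a \<in> S \<and> S \<inter> D = {}})"
    using le by (metis of_nat_le_iff of_nat_numeral of_nat_power)
  finally show ?thesis using assms(1) by (simp add: card_Pow)
qed

text \<open>By double counting, the average member of \<open>F\<close> covers at least a fraction \<open>\<delta>\<close> of the
  elements that are still uncovered; choose one that does at least as well.\<close>

lemma greedy_cover:
  fixes P :: "'b \<Rightarrow> 'a \<Rightarrow> bool" and \<delta> :: real
  assumes "finite F" "F \<noteq> {}" "finite X" "\<delta> \<le> 1"
    and dense: "\<And>x. x \<in> X \<Longrightarrow> \<delta> * card F \<le> card {S \<in> F. P S x}"
  shows "\<exists>S :: nat \<Rightarrow> 'b. (\<forall>i<d. S i \<in> F) \<and>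
           real (card {x \<in> X. \<forall>i<d. \<not> P (S i) x}) \<le> (1 - \<delta>) ^ d * card X"
proof (induction d)
  case 0
  show ?case by simp
next
  case (Suc d)
  then obtain S where S: "\<forall>i<d. S i \<in> F"
    and bound: "real (card {x \<in> X. \<forall>i<d. \<not> P (S i) x}) \<le> (1 - \<delta>) ^ d * card X"
    by blast
  define Y where "Y = {x \<in> X. \<forall>i<d. \<not> P (S i) x}"
  have finY: "finite Y" using assms by (simp add: Y_def)
  have "\<exists>T\<in>F. \<delta> * card Y \<le> card {x \<in> Y. P T x}"
  proof (rule ccontr)
    assume "\<not> ?thesis"
    hence less: "\<And>T. T \<in> F \<Longrightarrow> real (card {x \<in> Y. P T x}) < \<delta> * card Y"
      by (auto simp: not_le)
    have "(\<Sum>T\<in>F. real (card {x \<in> Y. P T x})) < (\<Sum>T\<in>F. \<delta> * card Y)"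
      using assms less by (intro sum_strict_mono) auto
    also have "\<dots> = (\<Sum>x\<in>Y. \<delta> * card F)" by simp
    also have "\<dots> \<le> (\<Sum>x\<in>Y. real (card {T \<in> F. P T x}))"
      using dense by (intro sum_mono) (auto simp: Y_def)
    also have "\<dots> = (\<Sum>T\<in>F. real (card {x \<in> Y. P T x}))"
      unfolding of_nat_sum[symmetric]
      by (subst sum_multicount_gen[OF assms(1) finY, where k = "\<lambda>x. card {T \<in> F. P T x}"]) auto
    finally show False by simp
  qed
  then obtain T where T: "T \<in> F" "\<delta> * card Y \<le> card {x \<in> Y. P T x}" by blast
  have "{x \<in> X. \<forall>i<Suc d. \<not> P ((S(d := T)) i) x} = Y - {x \<in> Y. P T x}"
    by (auto simp: Y_def less_Suc_eq)
  moreover have "card (Y - {x \<in> Y. P T x}) = card Y - card {x \<in> Y. P T x}"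
    using finY by (intro card_Diff_subset) auto
  moreover have "card {x \<in> Y. P T x} \<le> card Y"
    using finY by (intro card_mono) auto
  ultimately have "real (card {x \<in> X. \<forall>i<Suc d. \<not> P ((S(d := T)) i) x}) \<le> (1 - \<delta>) * card Y"
    using T(2) by (simp add: of_nat_diff algebra_simps)
  also have "\<dots> \<le> (1 - \<delta>) * ((1 - \<delta>) ^ d * card X)"
    using bound assms(4) unfolding Y_def by (intro mult_left_mono) auto
  finally have "real (card {x \<in> X. \<forall>i<Suc d. \<not> P ((S(d := T)) i) x}) \<le> (1 - \<delta>) ^ Suc d * card X"
    by (simp add: mult.assoc)
  moreover have "\<forall>i<Suc d. (S(d := T)) i \<in> F" using S T by (auto simp: less_Suc_eq)
  ultimately show ?case by blast
qed

text \<open>Coordinate \<open>i\<close> of the embedding is the indicator of the up-set generated by \<open>S i\<close>.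
  Transitivity makes it monotone, and the sets \<open>S i\<close> separate non-comparable pairs because
  the up-set omits \<open>b\<close> as soon as \<open>S i\<close> misses the principal ideal of \<open>b\<close>.\<close>

lemma embeds_in_chain_product_if_separated:
  assumes "refl_on A r" "trans r" "2 \<le> t"
    and S: "\<And>i. i < d \<Longrightarrow> S i \<subseteq> A"
    and sep: "\<And>a b. \<lbrakk>a \<in> A; b \<in> A; (a, b) \<notin> r\<rbrakk> \<Longrightarrow>
               \<exists>i<d. a \<in> S i \<and> S i \<inter> {x \<in> A. (x, b) \<in> r} = {}"
  shows "embeds_in_chain_product t d A r"
proof -
  define \<phi> where "\<phi> = (\<lambda>a. \<lambda>i\<in>{..<d}. if \<exists>s\<in>S i. (s, a) \<in> r then 1 else (0::nat))"
  let ?C = "\<lambda>i::nat. {0, 1::nat}" and ?R = "\<lambda>i::nat. {(0, 0), (0, 1), (1, 1::nat)}"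
  have lin: "linear_order_on {0, 1::nat} {(0, 0), (0, 1), (1, 1)}"
    unfolding order_on_defs refl_on_def trans_def antisym_def total_on_def by auto
  have "(\<phi> a, \<phi> b) \<in> coordinatewise_order {..<d} ?C ?R \<longleftrightarrow> (a, b) \<in> r"
    if "a \<in> A" "b \<in> A" for a b
  proof
    assume "(a, b) \<in> r"
    thus "(\<phi> a, \<phi> b) \<in> coordinatewise_order {..<d} ?C ?R"
      using assms(2) unfolding coordinatewise_order_def \<phi>_def trans_def by auto
  next
    assume *: "(\<phi> a, \<phi> b) \<in> coordinatewise_order {..<d} ?C ?R"
    show "(a, b) \<in> r"
    proof (rule ccontr)
      assume "(a, b) \<notin> r"
      then obtain i where i: "i < d" "a \<in> S i" "S i \<inter> {x \<in> A. (x, b) \<in> r} = {}"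
        using sep \<open>a \<in> A\<close> \<open>b \<in> A\<close> by blast
      have "(a, a) \<in> r" using assms(1) that by (auto simp: refl_on_def)
      hence "\<phi> a i = 1" using i by (auto simp: \<phi>_def)
      moreover have "\<phi> b i = 0" using i S[OF i(1)] by (auto simp: \<phi>_def)
      moreover have "(\<phi> a i, \<phi> b i) \<in> ?R i"
        using * i(1) unfolding coordinatewise_order_def by blast
      ultimately show False by simp
    qed
  qed
  moreover have "\<phi> \<in> A \<rightarrow> Pi\<^sub>E {..<d} ?C" by (auto simp: \<phi>_def)
  ultimately have "poset_embedding A r (Pi\<^sub>E {..<d} ?C) (coordinatewise_order {..<d} ?C ?R) \<phi>"
    unfolding poset_embedding_def by blast
  moreover have "\<forall>i<d. finite (?C i) \<and> card (?C i) \<le> t \<and> linear_order_on (?C i) (?R i)"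
    using lin assms(3) by simp
  ultimately show ?thesis
    unfolding embeds_in_chain_product_def
    by (intro exI[of _ ?C] exI[of _ ?R] exI[of _ \<phi>] conjI)
qed

text \<open>Each greedy step keeps at most a fraction \<open>1 - (1/2) ^ (K + 1)\<close> of the at most
  \<open>(card A)\<^sup>2\<close> pairs unseparated; fewer than one remaining pair means none.\<close>

lemma embeds_in_chain_product_if_small_ideals:
  assumes "finite A" "refl_on A r" "trans r" "2 \<le> t"
    and ideals: "\<And>b. b \<in> A \<Longrightarrow> card {x \<in> A. (x, b) \<in> r} \<le> K"
    and d: "(1 - (1/2) ^ (K + 1)) ^ d * (real (card A))\<^sup>2 < 1"
  shows "embeds_in_chain_product t d A r"
proof -
  let ?X = "{(a, b) \<in> A \<times> A. (a, b) \<notin> r}"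
  let ?P = "\<lambda>S (a, b). a \<in> S \<and> S \<inter> {x \<in> A. (x, b) \<in> r} = {}"
  let ?\<delta> = "(1/2 :: real) ^ (K + 1)"
  have finX: "finite ?X" using assms(1) by (auto intro: finite_subset[of _ "A \<times> A"])
  have \<delta>: "?\<delta> \<le> 1" by (rule power_le_one) auto
  have "?\<delta> * card (Pow A) \<le> card {S \<in> Pow A. ?P S x}" if "x \<in> ?X" for x
    using that card_separating_subsets[of A "{y \<in> A. (y, snd x) \<in> r}" K "fst x"]
      ideals[of "snd x"] assms(1)
    by (auto simp: case_prod_unfold)
  then obtain S where S: "\<forall>i<d. S i \<in> Pow A"
    and bound: "real (card {x \<in> ?X. \<forall>i<d. \<not> ?P (S i) x}) \<le> (1 - ?\<delta>) ^ d * card ?X"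
    using greedy_cover[of "Pow A" ?X ?\<delta> ?P d] assms(1) finX \<delta> by blast
  have "card ?X \<le> card (A \<times> A)" using assms(1) by (intro card_mono) auto
  hence "real (card ?X) \<le> real (card (A \<times> A))" by (simp only: of_nat_le_iff)
  also have "\<dots> = (real (card A))\<^sup>2" by (simp add: card_cartesian_product power2_eq_square)
  finally have "real (card ?X) \<le> (real (card A))\<^sup>2" .
  hence "(1 - ?\<delta>) ^ d * card ?X \<le> (1 - ?\<delta>) ^ d * (real (card A))\<^sup>2"
    using \<delta> by (intro mult_left_mono) auto
  with bound d have "card {x \<in> ?X. \<forall>i<d. \<not> ?P (S i) x} = 0" by linarith
  hence "{x \<in> ?X. \<forall>i<d. \<not> ?P (S i) x} = {}" using finX by (subst (asm) card_0_eq) auto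
  hence "\<exists>i<d. a \<in> S i \<and> S i \<inter> {x \<in> A. (x, b) \<in> r} = {}"
    if "a \<in> A" "b \<in> A" "(a, b) \<notin> r" for a b
    using that by blast
  with S assms(2-4) show ?thesis
    by (intro embeds_in_chain_product_if_separated[of A r t d S]) blast+
qed

lemma card_le_if_embeds_in_chain_product:
  assumes "embeds_in_chain_product t d A r" "refl_on A r" "antisym r"
  shows "card A \<le> t ^ d"
proof -
  obtain C :: "nat \<Rightarrow> nat set" and R \<phi> where C: "\<forall>i<d. finite (C i) \<and> card (C i) \<le> t \<and> linear_order_on (C i) (R i)"
    and \<phi>: "poset_embedding A r (Pi\<^sub>E {..<d} C) (coordinatewise_order {..<d} C R) \<phi>"
    using assms(1) unfolding embeds_in_chain_product_def by (elim exE conjE) (rule that)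
  have "inj_on \<phi> A"
  proof (rule inj_onI)
    fix a b assume ab: "a \<in> A" "b \<in> A" "\<phi> a = \<phi> b"
    have "(a, a) \<in> r" using ab assms(2) by (auto simp: refl_on_def)
    hence "(a, b) \<in> r" "(b, a) \<in> r" using ab \<phi> unfolding poset_embedding_def by metis+
    thus "a = b" using assms(3) by (auto dest: antisymD)
  qed
  moreover have "\<phi> ` A \<subseteq> Pi\<^sub>E {..<d} C" using \<phi> unfolding poset_embedding_def by blast
  moreover have "finite (Pi\<^sub>E {..<d} C)" using C by (intro finite_PiE) auto
  ultimately have "card A \<le> card (Pi\<^sub>E {..<d} C)" using card_inj_on_le by blast
  also have "\<dots> = (\<Prod>i<d. card (C i))" by (simp add: card_PiE)
  also have "\<dots> \<le> (\<Prod>i<d. t)" using C by (intro prod_mono) auto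
  finally show ?thesis by simp
qed

section \<open>The divisibility order on an interval\<close>

lemma div_carrier_eq:
  assumes "0 \<le> \<alpha>"
  shows "div_carrier \<alpha> n = {nat \<lfloor>\<alpha> * real n\<rfloor><..n}"
  using assms by (auto simp: div_carrier_def nat_less_iff floor_less_iff le_less_trans)

lemma card_div_carrier_ge:
  assumes "0 \<le> \<alpha>"
  shows "(1 - \<alpha>) * real n \<le> real (card (div_carrier \<alpha> n))"
proof -
  let ?k = "nat \<lfloor>\<alpha> * real n\<rfloor>"
  have "real n \<le> real ((n - ?k) + ?k)" unfolding of_nat_le_iff by simp
  moreover have "real ?k \<le> \<alpha> * real n" using assms by simp
  ultimately show ?thesis by (simp add: div_carrier_eq[OF assms] algebra_simps)
qed

lemma card_div_carrier_le:
  assumes "0 \<le> \<alpha>"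
  shows "card (div_carrier \<alpha> n) \<le> n"
  by (simp add: div_carrier_eq[OF assms])

lemma div_order_partial_order:
  "refl_on (div_carrier \<alpha> n) (div_order \<alpha> n)" "trans (div_order \<alpha> n)" "antisym (div_order \<alpha> n)"
  unfolding refl_on_def trans_def antisym_def div_order_def
  by (auto intro: dvd_trans dvd_antisym)

text \<open>A divisor \<open>x\<close> of \<open>b\<close> is determined by the quotient \<open>b div x\<close>, which is less than
  \<open>1 / \<alpha>\<close> when both numbers lie in the interval.\<close>

lemma card_div_order_ideal_le:
  assumes "0 < \<alpha>" "b \<in> div_carrier \<alpha> n"
  shows "card {x \<in> div_carrier \<alpha> n. (x, b) \<in> div_order \<alpha> n} \<le> nat \<lfloor>1 / \<alpha>\<rfloor>"
proof -
  let ?D = "{x \<in> div_carrier \<alpha> n. (x, b) \<in> div_order \<alpha> n}"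
  have b: "0 < b" "b \<le> n"
  proof -
    have "0 \<le> \<alpha> * real n" using assms(1) by simp
    thus "0 < b" "b \<le> n" using assms(2) unfolding div_carrier_def by auto
  qed
  have "inj_on (\<lambda>x. b div x) ?D"
  proof (rule inj_onI)
    fix x y assume xy: "x \<in> ?D" "y \<in> ?D" and eq: "b div x = b div y"
    have "x dvd b" "y dvd b" using xy by (auto simp: div_order_def)
    hence "b div x * x = b" "b div y * y = b" by auto
    thus "x = y" using eq b(1)
      by (metis mult_cancel_left mult_eq_0_iff less_irrefl)
  qed
  moreover have "(\<lambda>x. b div x) ` ?D \<subseteq> {1..nat \<lfloor>1 / \<alpha>\<rfloor>}"
  proof
    fix q assume "q \<in> (\<lambda>x. b div x) ` ?D"
    then obtain x where x: "x \<in> ?D" "q = b div x" by blast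
    have bq: "b = q * x" using x by (auto simp: div_order_def)
    hence q: "0 < q" using b(1) by (cases q) auto
    have "real q * (\<alpha> * real n) < real q * real x"
      using x(1) q by (intro mult_strict_left_mono) (auto simp: div_carrier_def)
    also have "\<dots> \<le> real n" using b(2) bq by (metis of_nat_le_iff of_nat_mult)
    finally have "real q * \<alpha> * real n < 1 * real n" by (simp add: mult.assoc)
    hence "real q * \<alpha> < 1" using b by (subst (asm) mult_less_cancel_right_pos) auto
    hence "real q \<le> 1 / \<alpha>" using assms(1) by (simp add: field_simps)
    thus "q \<in> {1..nat \<lfloor>1 / \<alpha>\<rfloor>}" using q by (simp add: le_nat_floor)
  qed
  ultimately have "card ?D \<le> card {1..nat \<lfloor>1 / \<alpha>\<rfloor>}"
    by (intro card_inj_on_le) auto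
  thus ?thesis by simp
qed

lemma embeds_div_order_in_chain_product:
  fixes \<alpha> :: real and t n d :: nat
  defines "\<delta> \<equiv> (1/2 :: real) ^ (nat \<lfloor>1 / \<alpha>\<rfloor> + 1)"
  assumes "0 < \<alpha>" "2 \<le> t" "0 < n" and d: "2 * ln (real n) / \<delta> < real d"
  shows "embeds_in_chain_product t d (div_carrier \<alpha> n) (div_order \<alpha> n)"
proof (rule embeds_in_chain_product_if_small_ideals)
  have \<delta>: "0 < \<delta>" "\<delta> \<le> 1" unfolding \<delta>_def by (simp, intro power_le_one) auto
  have "(1 - \<delta>) ^ d \<le> exp (- \<delta>) ^ d"
    using \<delta> exp_ge_add_one_self[of "- \<delta>"] by (intro power_mono) auto
  also have "\<dots> = exp (- (\<delta> * real d))" by (simp add: exp_of_nat_mult[symmetric] mult.commute)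
  also have "\<dots> < exp (- (2 * ln (real n)))"
    using d \<delta>(1) by (simp add: field_simps)
  also have "\<dots> = 1 / (real n)\<^sup>2"
    using assms(4) by (simp add: exp_minus exp_double field_simps)
  finally have less: "(1 - \<delta>) ^ d < 1 / (real n)\<^sup>2" .
  have "(1 - \<delta>) ^ d * (real (card (div_carrier \<alpha> n)))\<^sup>2 \<le> (1 - \<delta>) ^ d * (real n)\<^sup>2"
    using \<delta> card_div_carrier_le[of \<alpha> n] assms(2) by (intro mult_left_mono power_mono) auto
  also have "\<dots> < 1" using less assms(4) by (simp add: field_simps)
  finally show "(1 - (1/2) ^ (nat \<lfloor>1 / \<alpha>\<rfloor> + 1)) ^ d * (real (card (div_carrier \<alpha> n)))\<^sup>2 < 1"
    by (simp add: \<delta>_def)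
  show "finite (div_carrier \<alpha> n)" using assms(2) by (simp add: div_carrier_eq)
  show "card {x \<in> div_carrier \<alpha> n. (x, b) \<in> div_order \<alpha> n} \<le> nat \<lfloor>1 / \<alpha>\<rfloor>"
    if "b \<in> div_carrier \<alpha> n" for b
    using card_div_order_ideal_le[OF assms(2) that] .
qed (use div_order_partial_order assms(3) in auto)

section \<open>The logarithmic bounds\<close>

lemma div_tdim_upper:
  assumes "0 < \<alpha>" "2 \<le> t" "3 \<le> n"
  shows "real (div_tdim t \<alpha> n) \<le> (2 / (1/2) ^ (nat \<lfloor>1 / \<alpha>\<rfloor> + 1) + 1) * ln (real n)"
proof -
  let ?x = "2 * ln (real n) / (1/2) ^ (nat \<lfloor>1 / \<alpha>\<rfloor> + 1)"
  have ln1: "1 \<le> ln (real n)"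
  proof -
    have "exp 1 \<le> real n" using exp_le assms(3) by linarith
    thus ?thesis using assms(3) by (simp add: ln_ge_iff)
  qed
  hence x0: "0 \<le> ?x" by simp
  define d where "d = nat \<lfloor>?x\<rfloor> + 1"
  have "?x < real d" using x0 unfolding d_def by linarith
  hence "embeds_in_chain_product t d (div_carrier \<alpha> n) (div_order \<alpha> n)"
    using assms by (intro embeds_div_order_in_chain_product) auto
  hence "div_tdim t \<alpha> n \<le> d" unfolding div_tdim_def tdim_def by (rule Least_le)
  hence "real (div_tdim t \<alpha> n) \<le> real d" by simp
  also have "\<dots> \<le> ?x + 1" using x0 unfolding d_def by linarith
  also have "\<dots> \<le> ?x + ln (real n)" using ln1 by simp
  also have "\<dots> = (2 / (1/2) ^ (nat \<lfloor>1 / \<alpha>\<rfloor> + 1) + 1) * ln (real n)"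
    by (simp add: algebra_simps)
  finally show ?thesis .
qed

text \<open>The threshold \<open>1 / (1 - \<alpha>)\<^sup>2\<close> ensures that the factor \<open>1 - \<alpha>\<close> in the size of the
  interval costs at most half of \<open>ln n\<close>.\<close>

lemma div_tdim_lower:
  assumes "0 < \<alpha>" "\<alpha> < 1" "2 \<le> t" "0 < n" "1 / (1 - \<alpha>)\<^sup>2 \<le> real n"
  shows "1 / (2 * ln (real t)) * ln (real n) \<le> real (div_tdim t \<alpha> n)"
proof -
  let ?d = "div_tdim t \<alpha> n"
  \<comment> \<open>\<open>tdim\<close> is a \<open>LEAST\<close>, so it realises an embedding only once some dimension is known to work.\<close>
  obtain d where "2 * ln (real n) / (1/2) ^ (nat \<lfloor>1 / \<alpha>\<rfloor> + 1) < real d"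
    using reals_Archimedean2 by blast
  hence "embeds_in_chain_product t d (div_carrier \<alpha> n) (div_order \<alpha> n)"
    using assms by (intro embeds_div_order_in_chain_product) auto
  hence "embeds_in_chain_product t ?d (div_carrier \<alpha> n) (div_order \<alpha> n)"
    unfolding div_tdim_def tdim_def by (rule LeastI)
  hence "card (div_carrier \<alpha> n) \<le> t ^ ?d"
    using card_le_if_embeds_in_chain_product div_order_partial_order by blast
  hence "real (card (div_carrier \<alpha> n)) \<le> real t ^ ?d"
    by (metis of_nat_le_iff of_nat_power)
  with card_div_carrier_ge[of \<alpha> n] assms(1) have "(1 - \<alpha>) * real n \<le> real t ^ ?d" by linarith
  hence "ln ((1 - \<alpha>) * real n) \<le> ln (real t ^ ?d)"
    using assms by (subst ln_le_cancel_iff) auto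
  hence main: "ln (1 - \<alpha>) + ln (real n) \<le> real ?d * ln (real t)"
    using assms by (simp add: ln_mult ln_realpow)
  have "ln (1 / (1 - \<alpha>)\<^sup>2) \<le> ln (real n)"
    using assms by (subst ln_le_cancel_iff) auto
  hence "- (2 * ln (1 - \<alpha>)) \<le> ln (real n)"
    using assms by (simp add: ln_div ln_realpow)
  with main have "ln (real n) \<le> 2 * (real ?d * ln (real t))" by linarith
  moreover have "0 < ln (real t)" using assms by simp
  ultimately show ?thesis by (simp add: field_simps)
qed

lemma div_tdim_bounds:
  assumes "0 < \<alpha>" "\<alpha> < 1" "2 \<le> t"
  shows "\<exists>c C n0. c > 0 \<and> C > 0 \<and>
      (\<forall>n::nat. n \<ge> n0 \<longrightarrow>
        c * ln (real n) \<le> real (div_tdim t \<alpha> n) \<and>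
        real (div_tdim t \<alpha> n) \<le> C * ln (real n))"
proof (intro exI conjI allI impI)
  show "1 / (2 * ln (real t)) > 0" using assms by simp
  show "2 / (1/2) ^ (nat \<lfloor>1 / \<alpha>\<rfloor> + 1) + 1 > (0::real)" by (simp add: add_pos_pos)
  fix n :: nat
  assume n: "n \<ge> max 3 (nat \<lceil>1 / (1 - \<alpha>)\<^sup>2\<rceil>)"
  hence "1 / (1 - \<alpha>)\<^sup>2 \<le> real n" by linarith
  thus "1 / (2 * ln (real t)) * ln (real n) \<le> real (div_tdim t \<alpha> n)"
    using n assms by (intro div_tdim_lower) auto
  show "real (div_tdim t \<alpha> n) \<le> (2 / (1/2) ^ (nat \<lfloor>1 / \<alpha>\<rfloor> + 1) + 1) * ln (real n)"
    using n assms by (intro div_tdim_upper) auto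
qed

lemma div_tdim_bigtheta:
  assumes "0 < \<alpha>" "\<alpha> < 1" "2 \<le> t"
  shows "(\<lambda>n. real (div_tdim t \<alpha> n)) \<in> \<Theta>(\<lambda>n. ln (real n))"
proof -
  obtain c C n0 where c: "c > 0" "C > 0" and
    b: "\<And>n. n \<ge> n0 \<Longrightarrow> c * ln (real n) \<le> real (div_tdim t \<alpha> n) \<and>
        real (div_tdim t \<alpha> n) \<le> C * ln (real n)"
    using div_tdim_bounds[OF assms] by blast
  show ?thesis
  proof (rule bigthetaI'[OF c])
    show "\<forall>\<^sub>F n in sequentially. c * norm (ln (real n)) \<le> norm (real (div_tdim t \<alpha> n)) \<and>
        norm (real (div_tdim t \<alpha> n)) \<le> C * norm (ln (real n))"
      using eventually_ge_at_top[of "max n0 1"]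
    proof eventually_elim
      case (elim n)
      thus ?case using b[of n] by simp
    qed
  qed
qed

theorem mainTheorem4:
  fixes \<alpha> :: real and t :: nat
  assumes "0 < \<alpha>" and "\<alpha> < 1" and "2 \<le> t"
  shows "(\<lambda>n. real (div_tdim t \<alpha> n)) \<in> \<Theta>(\<lambda>n. ln (real n)) \<and>
    (\<exists>c C n0. c > 0 \<and> C > 0 \<and>
      (\<forall>n::nat. n \<ge> n0 \<longrightarrow>
        c * ln (real n) \<le> real (div_tdim t \<alpha> n) \<and>
        real (div_tdim t \<alpha> n) \<le> C * ln (real n))) \<and>
    (\<lambda>n. real (div_tdim 2 \<alpha> n)) \<in> \<Theta>(\<lambda>n. ln (real n))"
  using div_tdim_bigtheta[OF assms] div_tdim_bounds[OF assms] div_tdim_bigtheta[of \<alpha> 2] assms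
  by blast

end
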